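(* Let $G$ be a finite simple connected graph. The following are equivalent: (1) $G$ has at most one trivial distance ideal over $\mathbb{Z}$; (2) $G$ is $\{P_4,\mathsf{paw},\mathsf{diamond}\}$-free; (3) $G$ is (isomorphic to) an induced subgraph of a complete bipartite graph $K_{m,n}$ or of a complete graph $K_n$, for some positive integers $m,n$.
   Context: For a connected graph $G$ with vertex set $V$, $|V|=n$, let $d_G(u,v)$ be the number of edges in a shortest path from $u$ to $v$, let $D(G)$ be the distance matrix $(d_G(u,v))_{u,v\in V}$, let $X_G=\{x_u:u\in V\}$ be indeterminates, and let $D(G,X_G)=\mathrm{diag}(X_G)+D(G)$ be the generalized distance matrix. For a commutative ring $\mathcal{R}$ and $1\le i\le n$, the $i$-th distance ideal $I_i^{\mathcal{R}}(G,X_G)\subseteq \mathcal{R}[X_G]$ is the ideal generated by all $i\times i$ minors of $D(G,X_G)$ (determinants of arbitrary $i\times i$ submatrices). An ideal is trivial if it equals $\langle 1\rangle$. "Over $\mathbb{Z}$" means $\mathcal{R}=\mathbb{Z}$. $P_4$ is the path on 4 vertices; $\mathsf{paw}$ is a triangle with one pendant edge attached at one of its vertices (4 vertices); $\mathsf{diamond}$ is $K_4$ with one edge removed. A graph is $\mathcal{F}$-free if no induced subgraph of it is isomorphic to a graph in $\mathcal{F}$. *)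

theory Defs
  imports
    "Graph_Theory.Graph_Theory"
    "Jordan_Normal_Form.Determinant"
    "HOL-Algebra.Ideal"
    "HOL-Library.Poly_Mapping"
begin

text \<open>
  A finite simple graph is a \<open>pair_graph\<close>: a finite vertex set with a finite symmetric irreflexive
  arc relation, each edge being represented by its two opposite arcs. In particular a path in the
  symmetric digraph has as many arcs as the corresponding path of the graph has edges.
\<close>

subsection \<open>Distances\<close>

definition graph_dist :: "'a pair_pre_digraph \<Rightarrow> 'a \<Rightarrow> 'a \<Rightarrow> nat" where
  "graph_dist G u v = (LEAST k. \<exists>p. pre_digraph.apath (with_proj G) u p v \<and> length p = k)"

subsection \<open>Polynomials in the indeterminates indexed by a set\<close>

text \<open>
  The type \<^typ>\<open>('a \<Rightarrow>\<^sub>0 nat) \<Rightarrow>\<^sub>0 'r\<close> consists of the polynomials over \<^typ>\<open>'r\<close> in one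
  indeterminate for every element of \<^typ>\<open>'a\<close>; restricting the monomials to \<open>V\<close> gives \<open>R[x\<^sub>u : u \<in> V]\<close>.
\<close>

definition poly_ring :: "'a set \<Rightarrow> (('a \<Rightarrow>\<^sub>0 nat) \<Rightarrow>\<^sub>0 'r::comm_ring_1) ring" where
  "poly_ring V = \<lparr>carrier = {p. \<forall>m \<in> Poly_Mapping.keys p. Poly_Mapping.keys m \<subseteq> V},
     mult = (*), one = 1, zero = 0, add = (+)\<rparr>"

definition indet :: "'a \<Rightarrow> ('a \<Rightarrow>\<^sub>0 nat) \<Rightarrow>\<^sub>0 'r::comm_ring_1" where
  "indet u = Poly_Mapping.single (Poly_Mapping.single u 1) 1"

subsection \<open>Distance ideals\<close>

definition gen_dist_entry ::
    "'a pair_pre_digraph \<Rightarrow> 'a \<Rightarrow> 'a \<Rightarrow> ('a \<Rightarrow>\<^sub>0 nat) \<Rightarrow>\<^sub>0 'r::comm_ring_1" where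
  "gen_dist_entry G u v = (if u = v then indet u else 0) + of_nat (graph_dist G u v)"

text \<open>
  The rows and columns of the generalized distance matrix are indexed by vertices. A square
  submatrix is given by the lists of its rows and columns; reordering these lists only changes the
  sign of the minor, so all orders are allowed instead of fixing an enumeration of the vertices.
\<close>

definition gen_dist_submatrix ::
    "'a pair_pre_digraph \<Rightarrow> 'a list \<Rightarrow> 'a list \<Rightarrow> (('a \<Rightarrow>\<^sub>0 nat) \<Rightarrow>\<^sub>0 'r::comm_ring_1) mat" where
  "gen_dist_submatrix G us vs =
     mat (length us) (length vs) (\<lambda>(i, j). gen_dist_entry G (us ! i) (vs ! j))"

definition gen_dist_minors ::
    "'a pair_pre_digraph \<Rightarrow> nat \<Rightarrow> (('a \<Rightarrow>\<^sub>0 nat) \<Rightarrow>\<^sub>0 'r::comm_ring_1) set" where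
  "gen_dist_minors G i = {det (gen_dist_submatrix G us vs) | us vs.
     distinct us \<and> set us \<subseteq> pverts G \<and> length us = i \<and>
     distinct vs \<and> set vs \<subseteq> pverts G \<and> length vs = i}"

definition distance_ideal ::
    "'a pair_pre_digraph \<Rightarrow> nat \<Rightarrow> (('a \<Rightarrow>\<^sub>0 nat) \<Rightarrow>\<^sub>0 'r::comm_ring_1) set" where
  "distance_ideal G i = Idl\<^bsub>poly_ring (pverts G)\<^esub> (gen_dist_minors G i)"

text \<open>The following two facts ensure that \<^const>\<open>genideal\<close> is applied meaningfully.\<close>

lemma cring_poly_ring: "cring (poly_ring V :: (('a \<Rightarrow>\<^sub>0 nat) \<Rightarrow>\<^sub>0 'r::comm_ring_1) ring)"
proof -
  have mult: "p * q \<in> carrier (poly_ring V)"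
    if "p \<in> carrier (poly_ring V)" "q \<in> carrier (poly_ring V)"
    for p q :: "('a \<Rightarrow>\<^sub>0 nat) \<Rightarrow>\<^sub>0 'r"
    unfolding poly_ring_def
  proof (clarsimp)
    fix m x assume "m \<in> Poly_Mapping.keys (p * q)" "x \<in> Poly_Mapping.keys m"
    then obtain a b where "m = a + b" "a \<in> Poly_Mapping.keys p" "b \<in> Poly_Mapping.keys q"
      using keys_mult[of p q] by blast
    then show "x \<in> V"
      using \<open>x \<in> Poly_Mapping.keys m\<close> Poly_Mapping.keys_add[of a b] that
      by (auto simp: poly_ring_def)
  qed
  have add: "p + q \<in> carrier (poly_ring V)"
    if "p \<in> carrier (poly_ring V)" "q \<in> carrier (poly_ring V)"
    for p q :: "('a \<Rightarrow>\<^sub>0 nat) \<Rightarrow>\<^sub>0 'r"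
    using that Poly_Mapping.keys_add[of p q] by (fastforce simp: poly_ring_def)
  have neg: "- p \<in> carrier (poly_ring V)" if "p \<in> carrier (poly_ring V)"
    for p :: "('a \<Rightarrow>\<^sub>0 nat) \<Rightarrow>\<^sub>0 'r"
    using that by (simp add: poly_ring_def)
  have zero: "0 \<in> carrier (poly_ring V :: (('a \<Rightarrow>\<^sub>0 nat) \<Rightarrow>\<^sub>0 'r) ring)"
    and one: "1 \<in> carrier (poly_ring V :: (('a \<Rightarrow>\<^sub>0 nat) \<Rightarrow>\<^sub>0 'r) ring)"
    by (simp_all add: poly_ring_def)
  have ops: "mult (poly_ring V) = (*)" "Ring.add (poly_ring V) = (+)"
    "\<zero>\<^bsub>poly_ring V\<^esub> = (0 :: ('a \<Rightarrow>\<^sub>0 nat) \<Rightarrow>\<^sub>0 'r)"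
    "\<one>\<^bsub>poly_ring V\<^esub> = (1 :: ('a \<Rightarrow>\<^sub>0 nat) \<Rightarrow>\<^sub>0 'r)"
    by (simp_all add: poly_ring_def)
  have inv: "\<exists>q \<in> carrier (poly_ring V). q + p = 0" if "p \<in> carrier (poly_ring V)"
    for p :: "('a \<Rightarrow>\<^sub>0 nat) \<Rightarrow>\<^sub>0 'r"
    using neg[OF that] by (intro bexI[of _ "- p"]) simp_all
  show ?thesis
  proof (rule cringI)
    show "abelian_group (poly_ring V :: (('a \<Rightarrow>\<^sub>0 nat) \<Rightarrow>\<^sub>0 'r) ring)"
      by (rule abelian_groupI; unfold ops; (rule add zero inv | simp add: add.commute add.assoc))
    show "comm_monoid (poly_ring V :: (('a \<Rightarrow>\<^sub>0 nat) \<Rightarrow>\<^sub>0 'r) ring)"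
      by (rule comm_monoidI; unfold ops; (rule mult one | simp add: mult.commute mult.assoc))
  qed (unfold ops, rule distrib_right)
qed

lemma gen_dist_minors_carrier:
  "(gen_dist_minors G i :: (('a \<Rightarrow>\<^sub>0 nat) \<Rightarrow>\<^sub>0 'r::comm_ring_1) set) \<subseteq> carrier (poly_ring (pverts G))"
proof -
  let ?R = "poly_ring (pverts G) :: (('a \<Rightarrow>\<^sub>0 nat) \<Rightarrow>\<^sub>0 'r) ring"
  interpret cring ?R by (rule cring_poly_ring)
  have [simp]: "mult ?R = (*)" "add ?R = (+)" "\<zero>\<^bsub>?R\<^esub> = 0" "\<one>\<^bsub>?R\<^esub> = 1"
    by (simp_all add: poly_ring_def)
  have add: "p + q \<in> carrier ?R" if "p \<in> carrier ?R" "q \<in> carrier ?R" for p q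
    using a_closed[OF that] by simp
  have mult: "p * q \<in> carrier ?R" if "p \<in> carrier ?R" "q \<in> carrier ?R" for p q
    using m_closed[OF that] by simp
  have zero: "0 \<in> carrier ?R" and one: "1 \<in> carrier ?R"
    using zero_closed one_closed by simp_all
  have nat: "of_nat k \<in> carrier ?R" for k
    by (induction k) (use add zero one in auto)
  have neg: "- p \<in> carrier ?R" if "p \<in> carrier ?R" for p
    using that by (simp add: poly_ring_def)
  have sum: "sum f A \<in> carrier ?R" if "\<And>a. a \<in> A \<Longrightarrow> f a \<in> carrier ?R" for f and A :: "'b set"
    using that by (induction A rule: infinite_finite_induct) (use add zero in auto)
  have prod: "prod f A \<in> carrier ?R" if "\<And>a. a \<in> A \<Longrightarrow> f a \<in> carrier ?R" for f and A :: "'b set"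
    using that by (induction A rule: infinite_finite_induct) (use mult one in auto)
  have sgn: "signof \<pi> \<in> carrier ?R" for \<pi> :: "nat \<Rightarrow> nat"
    by (cases \<pi> rule: sign_cases) (use one neg in auto)
  have entry: "gen_dist_entry G u v \<in> carrier ?R" if "u \<in> pverts G" for u v
  proof -
    have "indet u \<in> carrier ?R"
      using that by (simp add: indet_def poly_ring_def)
    then show ?thesis
      unfolding gen_dist_entry_def using add nat zero by auto
  qed
  have "det (gen_dist_submatrix G us vs) \<in> carrier ?R"
    if "set us \<subseteq> pverts G" "length us = length vs" for us vs
  proof -
    have dim: "gen_dist_submatrix G us vs \<in> carrier_mat (length us) (length us)"
      using that by (simp add: gen_dist_submatrix_def)
    show ?thesis
      unfolding det_def'[OF dim]
    proof (intro sum mult sgn prod)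
      fix \<pi> j assume \<pi>: "\<pi> \<in> {\<pi>. \<pi> permutes {0..<length us}}" and j: "j \<in> {0..<length us}"
      then have "\<pi> j < length us"
        using permutes_in_image[of \<pi> "{0..<length us}" j] by simp
      with j that show "gen_dist_submatrix G us vs $$ (j, \<pi> j) \<in> carrier ?R"
        by (auto simp: gen_dist_submatrix_def intro!: entry)
    qed
  qed
  then show ?thesis
    by (auto simp: gen_dist_minors_def)
qed

subsection \<open>Induced subgraphs\<close>

definition has_induced_copy :: "('a, 'b) pre_digraph \<Rightarrow> ('c, 'd) pre_digraph \<Rightarrow> bool" where
  "has_induced_copy G F \<longleftrightarrow> (\<exists>H. induced_subgraph H G \<and> digraph_iso F H)"

definition induced_free :: "'c pair_pre_digraph set \<Rightarrow> 'a pair_pre_digraph \<Rightarrow> bool" where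
  "induced_free \<F> G \<longleftrightarrow> (\<forall>F \<in> \<F>. \<not> has_induced_copy (with_proj G) (with_proj F))"

definition P4 :: "nat pair_pre_digraph" where
  "P4 = (let E = {(0, 1), (1, 2), (2, 3)} in \<lparr>pverts = {0, 1, 2, 3}, parcs = E \<union> E\<inverse>\<rparr>)"

definition paw :: "nat pair_pre_digraph" where
  "paw = (let E = {(0, 1), (1, 2), (0, 2), (2, 3)} in \<lparr>pverts = {0, 1, 2, 3}, parcs = E \<union> E\<inverse>\<rparr>)"

definition diamond :: "nat pair_pre_digraph" where
  "diamond = (let E = {(0, 1), (0, 2), (1, 2), (1, 3), (2, 3)}
     in \<lparr>pverts = {0, 1, 2, 3}, parcs = E \<union> E\<inverse>\<rparr>)"

end

theory Submission
  imports Defs "HOL-Number_Theory.Cong"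
begin

text \<open>
  An induced \<open>P\<^sub>4\<close>, paw or diamond yields a minor \<open>d(a,b) d(c,d) - d(a,d) d(c,b) = \<plusminus>1\<close> off the
  diagonal, so the first two distance ideals are trivial. (For \<open>P\<^sub>4\<close> the ends have distance 2 or 3
  in \<open>G\<close>, and each case needs its own minor.) A connected graph without these subgraphs has diameter
  at most 2; if it has a triangle, every neighbour of a triangle vertex joins the triangle, which
  makes the graph complete, and otherwise the neighbourhood of a vertex and its complement are the
  sides of a complete bipartite graph. Finally, evaluating all indeterminates at 1 (complete case) or
  at 2 (bipartite case, modulo 3) turns the matrix into one of rank one, so all minors of order at
  least 2 lie in the kernel of a homomorphism to a nonzero ring.
\<close>

section \<open>Evaluation of polynomials\<close>

definition monom_eval :: "('a \<Rightarrow> 'r::comm_ring_1) \<Rightarrow> ('a \<Rightarrow>\<^sub>0 nat) \<Rightarrow> 'r" where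
  "monom_eval \<alpha> m = (\<Prod>u\<in>Poly_Mapping.keys m. \<alpha> u ^ Poly_Mapping.lookup m u)"

text \<open>Evaluation at the point \<open>\<alpha>\<close> is defined on the whole polynomial type,
  so that it becomes a \<open>comm_ring_hom\<close> and commutes with \<open>det\<close>.\<close>

definition poly_eval :: "('a \<Rightarrow> 'r::comm_ring_1) \<Rightarrow> (('a \<Rightarrow>\<^sub>0 nat) \<Rightarrow>\<^sub>0 'r) \<Rightarrow> 'r" where
  "poly_eval \<alpha> p = (\<Sum>m\<in>Poly_Mapping.keys p. Poly_Mapping.lookup p m * monom_eval \<alpha> m)"

text \<open>Indices outside the support contribute \<open>\<alpha> u ^ 0 = 1\<close>. This puts two
  monomials and their product over one index set.\<close>

lemma monom_eval_superset:
  assumes "finite A" "Poly_Mapping.keys m \<subseteq> A"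
  shows "monom_eval \<alpha> m = (\<Prod>u\<in>A. \<alpha> u ^ Poly_Mapping.lookup m u)"
  unfolding monom_eval_def using assms
  by (intro prod.mono_neutral_left) (auto simp: in_keys_iff)

lemma monom_eval_zero [simp]: "monom_eval \<alpha> 0 = 1"
  by (simp add: monom_eval_def)

lemma monom_eval_add: "monom_eval \<alpha> (m + n) = monom_eval \<alpha> m * monom_eval \<alpha> n"
proof -
  let ?A = "Poly_Mapping.keys m \<union> Poly_Mapping.keys n"
  have "monom_eval \<alpha> (m + n) = (\<Prod>u\<in>?A. \<alpha> u ^ Poly_Mapping.lookup (m + n) u)"
    using Poly_Mapping.keys_add[of m n] by (intro monom_eval_superset) auto
  also have "\<dots> = (\<Prod>u\<in>?A. \<alpha> u ^ Poly_Mapping.lookup m u) * (\<Prod>u\<in>?A. \<alpha> u ^ Poly_Mapping.lookup n u)"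
    by (simp add: lookup_add power_add prod.distrib)
  also have "\<dots> = monom_eval \<alpha> m * monom_eval \<alpha> n"
    by (simp add: monom_eval_superset[of ?A])
  finally show ?thesis .
qed

lemma poly_eval_add: "poly_eval \<alpha> (p + q) = poly_eval \<alpha> p + poly_eval \<alpha> q"
  unfolding poly_eval_def
  by (rule setsum_keys_plus_distrib) (simp_all add: algebra_simps)

lemma poly_eval_single [simp]: "poly_eval \<alpha> (Poly_Mapping.single m c) = c * monom_eval \<alpha> m"
  by (cases "c = 0") (simp_all add: poly_eval_def)

text \<open>Updating at a fresh key is the same as adding a \<open>single\<close>. The rule reduces
  statements that are additive in a polynomial to monomials.\<close>

lemma poly_mapping_single_induct [case_names zero single add]:
  fixes p :: "'a \<Rightarrow>\<^sub>0 'b::comm_monoid_add"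
  assumes "P 0" and single: "\<And>m c. P (Poly_Mapping.single m c)"
    and add: "\<And>p q. P p \<Longrightarrow> P q \<Longrightarrow> P (p + q)"
  shows "P p"
proof (induction p rule: Poly_Mapping.update_induct)
  case (update f a b)
  have "Poly_Mapping.update a b f = Poly_Mapping.single a b + f"
    using update.hyps
    by (intro poly_mapping_eqI)
      (auto simp: Poly_Mapping.lookup_update lookup_add lookup_single when_def in_keys_iff)
  then show ?case
    using add single update.IH by simp
qed (fact assms(1))

text \<open>Both sides are additive in \<open>p\<close> and in \<open>q\<close>, so two inductions
  leave only products of monomials, where exponents add.\<close>

lemma poly_eval_mult: "poly_eval \<alpha> (p * q) = poly_eval \<alpha> p * poly_eval \<alpha> q"
proof (induction p rule: poly_mapping_single_induct)
  case zero
  then show ?case by (simp add: poly_eval_def)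
next
  case (single m c)
  show ?case
  proof (induction q rule: poly_mapping_single_induct)
    case zero
    then show ?case by (simp add: poly_eval_def)
  next
    case (single n d)
    then show ?case by (simp add: mult_single monom_eval_add mult_ac)
  qed (simp add: poly_eval_add distrib_left)
qed (simp add: poly_eval_add distrib_right)

lemma comm_ring_hom_poly_eval: "comm_ring_hom (poly_eval \<alpha>)"
proof
  have "poly_eval \<alpha> (Poly_Mapping.single 0 1) = 1"
    by (subst poly_eval_single) simp
  then show "poly_eval \<alpha> 1 = 1" by simp
qed (simp_all add: poly_eval_add poly_eval_mult poly_eval_def[of _ 0])

lemma poly_eval_indet: "poly_eval \<alpha> (indet u) = \<alpha> u"
  by (simp add: indet_def monom_eval_def)

section \<open>Triviality of distance ideals\<close>

lemma poly_ring_simps [simp]: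
  "mult (poly_ring V) = (*)" "Ring.add (poly_ring V) = (+)"
  "\<zero>\<^bsub>poly_ring V\<^esub> = 0" "\<one>\<^bsub>poly_ring V\<^esub> = 1"
  by (simp_all add: poly_ring_def)

lemma Idl_one_poly_ring: "Idl\<^bsub>poly_ring V\<^esub> {1} = carrier (poly_ring V)"
  using cring.axioms(1)[OF cring_poly_ring, THEN ring.genideal_one, of V] by simp

lemma ideal_distance_ideal: "ideal (distance_ideal G i) (poly_ring (pverts G))"
  unfolding distance_ideal_def
  by (rule ring.genideal_ideal[OF cring.axioms(1)[OF cring_poly_ring] gen_dist_minors_carrier])

lemma gen_dist_minors_subset_distance_ideal: "gen_dist_minors G i \<subseteq> distance_ideal G i"
  unfolding distance_ideal_def
  by (rule ring.genideal_self[OF cring.axioms(1)[OF cring_poly_ring] gen_dist_minors_carrier])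

lemma det_in_gen_dist_minors:
  assumes "distinct us" "set us \<subseteq> pverts G" "distinct vs" "set vs \<subseteq> pverts G" "length us = length vs"
  shows "det (gen_dist_submatrix G us vs) \<in> gen_dist_minors G (length us)"
  using assms by (auto simp: gen_dist_minors_def)

text \<open>An ideal that contains the unit \<open>p\<close> contains \<open>p * q = 1\<close>. The
  inverse must itself be a polynomial in the vertex indeterminates.\<close>

lemma distance_ideal_trivialI:
  fixes p q :: "('a \<Rightarrow>\<^sub>0 nat) \<Rightarrow>\<^sub>0 'r::comm_ring_1"
  assumes p: "p \<in> gen_dist_minors G i" and q: "q \<in> carrier (poly_ring (pverts G))" "p * q = 1"
  shows "(distance_ideal G i :: (('a \<Rightarrow>\<^sub>0 nat) \<Rightarrow>\<^sub>0 'r) set) = Idl\<^bsub>poly_ring (pverts G)\<^esub> {1}"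
proof -
  interpret ideal "distance_ideal G i :: (('a \<Rightarrow>\<^sub>0 nat) \<Rightarrow>\<^sub>0 'r) set" "poly_ring (pverts G)"
    by (rule ideal_distance_ideal)
  have "p \<otimes>\<^bsub>poly_ring (pverts G)\<^esub> q \<in> distance_ideal G i"
    using p q gen_dist_minors_subset_distance_ideal by (intro I_r_closed) auto
  then show ?thesis
    unfolding Idl_one_poly_ring using q by (intro one_imp_carrier) simp
qed

text \<open>This is the kernel of evaluation followed by reduction modulo \<open>d\<close>,
  expressed by divisibility so that no quotient ring has to be formed. For \<open>d = 0\<close> it
  is the kernel of evaluation itself.\<close>

lemma ideal_poly_eval_dvd:
  fixes d :: "'b::comm_ring_1" and \<alpha> :: "'a \<Rightarrow> 'b"
  shows "ideal {p \<in> carrier (poly_ring V). d dvd poly_eval \<alpha> p} (poly_ring V)"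
proof -
  interpret hom: comm_ring_hom "poly_eval \<alpha>"
    by (rule comm_ring_hom_poly_eval)
  interpret cring "poly_ring V"
    by (rule cring_poly_ring)
  let ?I = "{p \<in> carrier (poly_ring V). d dvd poly_eval \<alpha> p}"
  \<comment> \<open>\<open>subgroup\<close> refers to the inverse in the additive monoid of the
    record; it is identified here with negation on the type.\<close>
  have uminus: "inv\<^bsub>add_monoid (poly_ring V)\<^esub> p = - p" if "p \<in> carrier (poly_ring V)" for p :: "('a \<Rightarrow>\<^sub>0 nat) \<Rightarrow>\<^sub>0 'b"
    unfolding a_inv_def[symmetric] using that by (intro minus_equality) (simp_all add: poly_ring_def)
  show ?thesis
  proof (rule idealI)
    show "ring (poly_ring V)" by (rule ring_axioms)
    show "subgroup ?I (add_monoid (poly_ring V))"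
    proof (rule subgroup.intro)
      fix p assume p: "p \<in> ?I"
      then have "- p \<in> carrier (poly_ring V)"
        by (simp add: poly_ring_def)
      with p show "inv\<^bsub>add_monoid (poly_ring V)\<^esub> p \<in> ?I"
        by (subst uminus) (auto simp: hom.hom_uminus)
    next
      fix p q assume "p \<in> ?I" "q \<in> ?I"
      then show "p \<otimes>\<^bsub>add_monoid (poly_ring V)\<^esub> q \<in> ?I"
        using a_closed[of p q] by (simp add: hom.hom_add)
    qed (use zero_closed in auto)
  next
    fix p q :: "('a \<Rightarrow>\<^sub>0 nat) \<Rightarrow>\<^sub>0 'b"
    assume "p \<in> ?I" "q \<in> carrier (poly_ring V)"
    then show "q \<otimes>\<^bsub>poly_ring V\<^esub> p \<in> ?I" "p \<otimes>\<^bsub>poly_ring V\<^esub> q \<in> ?I"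
      using m_closed[of p q] m_closed[of q p] by (auto simp: hom.hom_mult)
  qed
qed

section \<open>Determinants of rank-one matrices, of order two, and under congruence\<close>

text \<open>Column times row, padded with zeros to a product of square matrices
  \<open>A * B\<close>. The second factor has a zero row, so the argument works over any commutative
  ring.\<close>

lemma det_rank_one:
  fixes f g :: "nat \<Rightarrow> 'r::comm_ring_1"
  assumes "n \<ge> 2"
  shows "det (mat n n (\<lambda>(i, j). f i * g j)) = 0"
proof -
  define A where "A = mat n n (\<lambda>(i, j). if j = 0 then f i else 0)"
  define B where "B = mat n n (\<lambda>(i, j). if i = 0 then g j else 0)"
  have A: "A \<in> carrier_mat n n" and B: "B \<in> carrier_mat n n"
    by (simp_all add: A_def B_def)
  have "mat n n (\<lambda>(i, j). f i * g j) = A * B"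
  proof (rule eq_matI)
    fix i j assume ij: "i < dim_row (A * B)" "j < dim_col (A * B)"
    then have "(A * B) $$ (i, j) = (\<Sum>k = 0..<n. (if k = 0 then f i else 0) * (if k = 0 then g j else 0))"
      by (auto simp: A_def B_def scalar_prod_def intro!: sum.cong)
    also have "\<dots> = (\<Sum>k = 0..<n. if k = 0 then f i * g j else 0)"
      by (intro sum.cong) auto
    also have "\<dots> = f i * g j"
      using assms by simp
    finally show "mat n n (\<lambda>(i, j). f i * g j) $$ (i, j) = (A * B) $$ (i, j)"
      using ij by (simp add: A_def B_def)
  qed (simp_all add: A_def B_def)
  moreover have "det B = 0"
    unfolding det_def'[OF B]
  proof (intro sum.neutral ballI)
    fix p assume "p \<in> {p. p permutes {0..<n}}"
    \<comment> \<open>Row 1 exists because \<open>n \<ge> 2\<close>, and only row 0 of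
      \<open>B\<close> is nonzero; hence every term of the Leibniz sum contains a zero
      factor.\<close>
    then have "B $$ (1, p 1) = 0"
      using assms permutes_in_image[of p "{0..<n}" 1] by (auto simp: B_def)
    then have "(\<Prod>i = 0..<n. B $$ (i, p i)) = 0"
      using assms by (intro prod_zero bexI[of _ 1]) auto
    then show "signof p * (\<Prod>i = 0..<n. B $$ (i, p i)) = 0"
      by simp
  qed
  ultimately show ?thesis
    using det_mult[OF A B] by simp
qed

lemma det_two:
  fixes A :: "'r::comm_ring_1 mat"
  assumes "A \<in> carrier_mat 2 2"
  shows "det A = A $$ (0, 0) * A $$ (1, 1) - A $$ (0, 1) * A $$ (1, 0)"
proof -
  have "det A = (\<Sum>i<2. A $$ (i, 0) * cofactor A i 0)"
    using assms by (intro laplace_expansion_column) auto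
  moreover have "mat_delete A i j \<in> carrier_mat 1 1" for i j
    using assms by (auto simp: mat_delete_def)
  ultimately show ?thesis
    using assms by (simp add: numeral_2_eq_2 cofactor_def det_single mat_delete_def)
qed

text \<open>By the Leibniz formula the determinant is an integer polynomial in the entries, and sums
  and products respect congruence.\<close>

lemma det_cong:
  fixes A B :: "int mat"
  assumes "A \<in> carrier_mat n n" "B \<in> carrier_mat n n"
    and "\<And>i j. i < n \<Longrightarrow> j < n \<Longrightarrow> [A $$ (i, j) = B $$ (i, j)] (mod d)"
  shows "[det A = det B] (mod d)"
  unfolding det_def'[OF assms(1)] det_def'[OF assms(2)]
  by (intro cong_sum cong_scalar_left cong_prod assms(3)) auto

text \<open>If evaluation at \<alpha> gives the matrix rank one modulo \<open>d\<close>, all its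
  minors of order \<open>i \<ge> 2\<close> lie in the kernel of evaluation modulo \<open>d\<close>.
  That ideal is proper because \<open>d\<close> does not divide 1.\<close>

lemma distance_ideal_nontrivial:
  fixes \<alpha> f g :: "'a \<Rightarrow> int"
  assumes cong: "\<And>u v. u \<in> pverts G \<Longrightarrow> v \<in> pverts G \<Longrightarrow>
      [poly_eval \<alpha> (gen_dist_entry G u v) = f u * g v] (mod d)"
    and d: "\<not> d dvd 1" and i: "i \<ge> 2"
  shows "(distance_ideal G i :: (('a \<Rightarrow>\<^sub>0 nat) \<Rightarrow>\<^sub>0 int) set) \<noteq> Idl\<^bsub>poly_ring (pverts G)\<^esub> {1}"
proof
  let ?R = "poly_ring (pverts G) :: (('a \<Rightarrow>\<^sub>0 nat) \<Rightarrow>\<^sub>0 int) ring"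
  let ?I = "{p \<in> carrier ?R. d dvd poly_eval \<alpha> p}"
  interpret hom: comm_ring_hom "poly_eval \<alpha>"
    by (rule comm_ring_hom_poly_eval)
  interpret cring ?R
    by (rule cring_poly_ring)
  have "d dvd poly_eval \<alpha> (det (gen_dist_submatrix G us vs))"
    if "set us \<subseteq> pverts G" "set vs \<subseteq> pverts G" "length us = i" "length vs = i" for us vs
  proof -
    have "[det (map_mat (poly_eval \<alpha>) (gen_dist_submatrix G us vs))
        = det (mat i i (\<lambda>(k, l). f (us ! k) * g (vs ! l)))] (mod d)"
      using that by (intro det_cong[of _ i]) (auto simp: gen_dist_submatrix_def intro!: cong)
    then show ?thesis
      using i by (simp add: hom.hom_det det_rank_one cong_0_iff)
  qed
  then have "d dvd poly_eval \<alpha> p" if "p \<in> gen_dist_minors G i" for p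
    using that by (auto simp: gen_dist_minors_def)
  then have "gen_dist_minors G i \<subseteq> ?I"
    using gen_dist_minors_carrier[of G i] by blast
  then have "distance_ideal G i \<subseteq> ?I"
    unfolding distance_ideal_def by (intro genideal_minimal ideal_poly_eval_dvd)
  moreover assume "distance_ideal G i = Idl\<^bsub>?R\<^esub> {1}"
  then have "(1 :: ('a \<Rightarrow>\<^sub>0 nat) \<Rightarrow>\<^sub>0 int) \<in> distance_ideal G i"
    using one_closed by (simp add: Idl_one_poly_ring)
  ultimately show False
    using d by auto
qed

section \<open>Small distances\<close>

lemma graph_dist_le:
  "pre_digraph.apath (with_proj G) u p v \<Longrightarrow> graph_dist G u v \<le> length p"
  unfolding graph_dist_def by (rule Least_le) auto

text \<open>The given path shows that the set of lengths under \<open>LEAST\<close> is nonempty, so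
  the minimum is realised.\<close>

lemma graph_dist_attained:
  assumes "pre_digraph.apath (with_proj G) u p v"
  obtains q where "pre_digraph.apath (with_proj G) u q v" "length q = graph_dist G u v"
proof -
  have "\<exists>q. pre_digraph.apath (with_proj G) u q v \<and> length q = graph_dist G u v"
    unfolding graph_dist_def by (rule LeastI[of _ "length p"]) (use assms in auto)
  then show thesis using that by blast
qed

context pair_graph
begin

lemma graph_dist_self: "u \<in> pverts G \<Longrightarrow> graph_dist G u u = 0"
  using graph_dist_le[of G u "[]" u] by (simp add: apath_Nil_iff)

lemma graph_dist_pos:
  assumes "apath u p v" "u \<noteq> v"
  shows "graph_dist G u v \<ge> 1"
proof (rule graph_dist_attained[OF assms(1)])
  fix q assume "apath u q v" "length q = graph_dist G u v"
  then show ?thesis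
    using assms(2) by (cases q) (auto simp: apath_simps)
qed

text \<open>A path of length 1 would be the single arc \<open>(u, v)\<close>.\<close>

lemma graph_dist_ge_2:
  assumes "apath u p v" "u \<noteq> v" "(u, v) \<notin> parcs G"
  shows "graph_dist G u v \<ge> 2"
proof (rule graph_dist_attained[OF assms(1)])
  fix q assume q: "apath u q v" "length q = graph_dist G u v"
  have "length q \<noteq> 1"
    using q(1) assms(3) by (auto simp: length_Suc_conv apath_simps)
  then show ?thesis
    using q(2) graph_dist_pos[OF assms(1,2)] by linarith
qed

lemma graph_dist_adj:
  assumes "(u, v) \<in> parcs G"
  shows "graph_dist G u v = 1"
proof -
  have "u \<noteq> v" using assms no_loops' by auto
  then have "apath u [(u, v)] v"
    using assms by (auto simp: apath_simps dest: in_arcsD2)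
  then show ?thesis
    using graph_dist_pos[of u _ v] graph_dist_le[of G u _ v] \<open>u \<noteq> v\<close> by fastforce
qed

lemma graph_dist_common_neighbour:
  assumes "(u, w) \<in> parcs G" "(w, v) \<in> parcs G" "u \<noteq> v" "(u, v) \<notin> parcs G"
  shows "graph_dist G u v = 2"
proof -
  have "u \<noteq> w" "w \<noteq> v" using assms no_loops' by auto
  then have "apath u [(u, w), (w, v)] v"
    using assms by (auto simp: apath_simps dest: in_arcsD2)
  then show ?thesis
    using graph_dist_ge_2[of u _ v] graph_dist_le[of G u _ v] assms by fastforce
qed

text \<open>Both values can occur: distances are taken in all of \<open>G\<close>, where a vertex
  off the path may be a common neighbour of \<open>a\<close> and \<open>d\<close>.\<close>

lemma graph_dist_path_3:
  assumes "(a, b) \<in> parcs G" "(b, c) \<in> parcs G" "(c, d) \<in> parcs G" "distinct [a, b, c, d]" "(a, d) \<notin> parcs G"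
  shows "graph_dist G a d \<in> {2, 3}"
proof -
  have "apath a [(a, b), (b, c), (c, d)] d"
    using assms by (auto simp: apath_simps dest: in_arcsD2)
  then have "2 \<le> graph_dist G a d" "graph_dist G a d \<le> 3"
    using graph_dist_ge_2[of a _ d] graph_dist_le[of G a _ d] assms by fastforce+
  then show ?thesis by auto
qed

end

section \<open>Induced copies\<close>

text \<open>An isomorphism record has separate maps for vertices, arcs, heads and tails. Between
  pair digraphs the vertex map determines the others, so an induced copy amounts to an injection
  that preserves and reflects adjacency.\<close>

lemma has_induced_copy_iff:
  assumes F: "pair_wf_digraph F" and G: "pair_wf_digraph G"
  shows "has_induced_copy (with_proj G) (with_proj F) \<longleftrightarrow>
    (\<exists>f. inj_on f (pverts F) \<and> f ` pverts F \<subseteq> pverts G \<and>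
      (\<forall>u\<in>pverts F. \<forall>v\<in>pverts F. (u, v) \<in> parcs F \<longleftrightarrow> (f u, f v) \<in> parcs G))"
    (is "_ \<longleftrightarrow> ?R")
proof
  interpret F: pair_wf_digraph F by (rule F)
  assume "has_induced_copy (with_proj G) (with_proj F)"
  then obtain h where ind: "induced_subgraph (app_iso h (with_proj F)) (with_proj G)"
    and iso: "F.digraph_isomorphism h"
    by (auto simp: has_induced_copy_def digraph_iso_def)
  \<comment> \<open>A subgraph is compatible with its host, so the image graph must use the
    projections of \<open>G\<close> as tail and head.\<close>
  have ht: "iso_tail h = fst" "iso_head h = snd"
    using ind by (auto simp: induced_subgraph_def subgraph_def compatible_def)
  have arc: "iso_arcs h e = (iso_verts h (fst e), iso_verts h (snd e))" if "e \<in> parcs F" for e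
    using iso that ht by (auto simp: F.digraph_isomorphism_def prod_eq_iff)
  have inj: "inj_on (iso_verts h) (pverts F)"
    using iso by (auto simp: F.digraph_isomorphism_def)
  have arcs: "iso_arcs h ` parcs F = {e \<in> parcs G. fst e \<in> iso_verts h ` pverts F \<and> snd e \<in> iso_verts h ` pverts F}"
    using ind ht by (simp add: induced_subgraph_def)
  have "(u, v) \<in> parcs F \<longleftrightarrow> (iso_verts h u, iso_verts h v) \<in> parcs G"
    if uv: "u \<in> pverts F" "v \<in> pverts F" for u v
  proof
    assume "(u, v) \<in> parcs F"
    then have "iso_arcs h (u, v) \<in> parcs G"
      using arcs by blast
    then show "(iso_verts h u, iso_verts h v) \<in> parcs G"
      using arc[OF \<open>(u, v) \<in> parcs F\<close>] by simp
  next
    assume "(iso_verts h u, iso_verts h v) \<in> parcs G"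
    then have "(iso_verts h u, iso_verts h v) \<in> iso_arcs h ` parcs F"
      using arcs uv by auto
    then obtain e where e: "e \<in> parcs F" "(iso_verts h u, iso_verts h v) = iso_arcs h e"
      by auto
    then have "iso_verts h u = iso_verts h (fst e)" "iso_verts h v = iso_verts h (snd e)"
      using arc by auto
    then have "u = fst e" "v = snd e"
      using inj uv e(1) F.arc_fst_in_verts F.arc_snd_in_verts by (metis inj_onD)+
    then show "(u, v) \<in> parcs F"
      using e(1) by simp
  qed
  moreover have "iso_verts h ` pverts F \<subseteq> pverts G"
    using ind by (auto simp: induced_subgraph_def subgraph_def)
  ultimately show ?R
    using inj by blast
next
  interpret F: pair_wf_digraph F by (rule F)
  interpret G: pair_wf_digraph G by (rule G)
  assume ?R
  then obtain f where inj: "inj_on f (pverts F)" and sub: "f ` pverts F \<subseteq> pverts G"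
    and adj: "\<And>u v. u \<in> pverts F \<Longrightarrow> v \<in> pverts F \<Longrightarrow> (u, v) \<in> parcs F \<longleftrightarrow> (f u, f v) \<in> parcs G"
    by blast
  define h where "h = \<lparr>iso_verts = f, iso_arcs = map_prod f f, iso_head = snd, iso_tail = fst\<rparr>"
  have "inj_on (map_prod f f) (parcs F)"
    by (rule inj_on_subset[OF map_prod_inj_on[OF inj inj]]) (auto dest: F.wellformed')
  then have iso: "F.digraph_isomorphism h"
    using inj F.wf_digraph_axioms by (auto simp: F.digraph_isomorphism_def h_def)
  have wf: "wf_digraph (app_iso h (with_proj F))"
    by (rule F.wf_digraphI_app_iso[OF iso])
  have "map_prod f f ` parcs F = {e \<in> parcs G. fst e \<in> f ` pverts F \<and> snd e \<in> f ` pverts F}"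
  proof (intro equalityI subsetI)
    fix e assume "e \<in> {e \<in> parcs G. fst e \<in> f ` pverts F \<and> snd e \<in> f ` pverts F}"
    then obtain u v where uv: "u \<in> pverts F" "v \<in> pverts F" "e = (f u, f v)" "(f u, f v) \<in> parcs G"
      by (cases e) auto
    then have "(u, v) \<in> parcs F" using adj by simp
    then show "e \<in> map_prod f f ` parcs F" using uv(3) by force
  next
    fix e assume "e \<in> map_prod f f ` parcs F"
    then obtain u v where uv: "(u, v) \<in> parcs F" "e = (f u, f v)"
      by auto
    then show "e \<in> {e \<in> parcs G. fst e \<in> f ` pverts F \<and> snd e \<in> f ` pverts F}"
      using adj[of u v] F.wellformed'[OF uv(1)] by auto
  qed
  then have "induced_subgraph (app_iso h (with_proj F)) (with_proj G)"
    using sub wf G.wf_digraph_axioms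
    unfolding induced_subgraph_def subgraph_def compatible_def by (auto simp: h_def)
  then show "has_induced_copy (with_proj G) (with_proj F)"
    using iso by (auto simp: has_induced_copy_def digraph_iso_def)
qed

text \<open>The embedding is written as indexing into the list \<open>[a, b, c, d]\<close>, and the
  bounded quantifiers run over explicit sets, so that the simplifier can expand them for a concrete
  \<open>F\<close>.\<close>

lemma has_induced_copy_four_vertices:
  assumes "pair_wf_digraph F" "pair_wf_digraph G" and F: "pverts F = {0, 1, 2, 3 :: nat}"
  shows "has_induced_copy (with_proj G) (with_proj F) \<longleftrightarrow>
    (\<exists>a b c d. distinct [a, b, c, d] \<and> {a, b, c, d} \<subseteq> pverts G \<and>
      (\<forall>i\<in>{0, 1, 2, 3}. \<forall>j\<in>{0, 1, 2, 3}.
        (i, j) \<in> parcs F \<longleftrightarrow> ([a, b, c, d] ! i, [a, b, c, d] ! j) \<in> parcs G))"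
    (is "_ \<longleftrightarrow> ?R")
  unfolding has_induced_copy_iff[OF assms(1,2)] F
proof
  assume "\<exists>f. inj_on f {0, 1, 2, 3} \<and> f ` {0, 1, 2, 3} \<subseteq> pverts G \<and>
    (\<forall>u\<in>{0, 1, 2, 3}. \<forall>v\<in>{0, 1, 2, 3}. ((u, v) \<in> parcs F) = ((f u, f v) \<in> parcs G))"
  then obtain f where f: "inj_on f {0, 1, 2, 3}" "f ` {0, 1, 2, 3} \<subseteq> pverts G"
    "\<forall>u\<in>{0, 1, 2, 3}. \<forall>v\<in>{0, 1, 2, 3}. ((u, v) \<in> parcs F) = ((f u, f v) \<in> parcs G)"
    by blast
  have "[f 0, f 1, f 2, f 3] ! i = f i" if "i \<in> {0, 1, 2, 3}" for i
    using that by auto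
  moreover have "distinct [f 0, f 1, f 2, f 3]"
    using f(1) by (auto simp: inj_on_def)
  ultimately show ?R
    using f(2,3) by (intro exI[of _ "f 0"] exI[of _ "f 1"] exI[of _ "f 2"] exI[of _ "f 3"]) simp
next
  assume ?R
  then obtain a b c d where abcd: "distinct [a, b, c, d]" "{a, b, c, d} \<subseteq> pverts G"
    "\<forall>i\<in>{0, 1, 2, 3}. \<forall>j\<in>{0, 1, 2, 3}.
        (i, j) \<in> parcs F \<longleftrightarrow> ([a, b, c, d] ! i, [a, b, c, d] ! j) \<in> parcs G"
    by blast
  have "inj_on ((!) [a, b, c, d]) {0, 1, 2, 3}"
    by (rule inj_on_subset[OF inj_on_nth[OF abcd(1), of "{..<4}"]]) auto
  moreover have "(!) [a, b, c, d] ` {0, 1, 2, 3} \<subseteq> pverts G"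
    using abcd(2) by simp
  ultimately show "\<exists>f. inj_on f {0, 1, 2, 3} \<and> f ` {0, 1, 2, 3} \<subseteq> pverts G \<and>
    (\<forall>u\<in>{0, 1, 2, 3}. \<forall>v\<in>{0, 1, 2, 3}. ((u, v) \<in> parcs F) = ((f u, f v) \<in> parcs G))"
    using abcd(3) by blast
qed

section \<open>Adjacency patterns of the three forbidden graphs\<close>

lemma pair_wf_digraph_forbidden:
  "pair_wf_digraph P4" "pair_wf_digraph paw" "pair_wf_digraph diamond"
  by (unfold_locales; auto simp: P4_def paw_def diamond_def Let_def)+

context pair_graph
begin

lemma parcs_commute: "(u, v) \<in> parcs G \<longleftrightarrow> (v, u) \<in> parcs G"
  using arcs_symmetric by blast

lemma not_loop [simp]: "(u, u) \<notin> parcs G"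
  using no_loops' by blast

text \<open>The pattern already forces four distinct vertices: any two of them are adjacent or are
  told apart by their adjacency to a third.\<close>

lemma has_induced_copy_P4_iff:
  "has_induced_copy (with_proj G) (with_proj P4) \<longleftrightarrow>
    (\<exists>a b c d. (a, b) \<in> parcs G \<and> (b, c) \<in> parcs G \<and> (c, d) \<in> parcs G \<and>
      (a, c) \<notin> parcs G \<and> (a, d) \<notin> parcs G \<and> (b, d) \<notin> parcs G)"
proof -
  \<comment> \<open>Symmetry and the absence of loops reduce the sixteen conditions to one for each
    of the six pairs.\<close>
  have eq: "(\<forall>i\<in>{0, 1, 2, 3}. \<forall>j\<in>{0, 1, 2, 3}.
        (i, j) \<in> parcs P4 \<longleftrightarrow> ([a, b, c, d] ! i, [a, b, c, d] ! j) \<in> parcs G) \<longleftrightarrow>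
    (a, b) \<in> parcs G \<and> (b, c) \<in> parcs G \<and> (c, d) \<in> parcs G \<and>
      (a, c) \<notin> parcs G \<and> (a, d) \<notin> parcs G \<and> (b, d) \<notin> parcs G" for a b c d
    by (auto simp: P4_def Let_def parcs_commute[of b a] parcs_commute[of c a] parcs_commute[of d a]
        parcs_commute[of c b] parcs_commute[of d b] parcs_commute[of d c])
  have V: "pverts P4 = {0, 1, 2, 3}"
    by (simp add: P4_def Let_def)
  have "distinct [a, b, c, d] \<and> {a, b, c, d} \<subseteq> pverts G"
    if "(a, b) \<in> parcs G" "(b, c) \<in> parcs G" "(c, d) \<in> parcs G"
      "(a, c) \<notin> parcs G" "(a, d) \<notin> parcs G" "(b, d) \<notin> parcs G" for a b c d
    using that by (intro conjI, simp, metis not_loop arcs_symmetric) (auto dest: wellformed')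
  then show ?thesis
    unfolding has_induced_copy_four_vertices[OF pair_wf_digraph_forbidden(1) pair_wf_digraph_axioms V] eq
    by blast
qed

text \<open>Here \<open>c\<close> is the vertex of degree three and \<open>d\<close> the pendant
  one. As for \<open>P4\<close>, the pattern forces distinctness.\<close>

lemma has_induced_copy_paw_iff:
  "has_induced_copy (with_proj G) (with_proj paw) \<longleftrightarrow>
    (\<exists>a b c d. (a, b) \<in> parcs G \<and> (b, c) \<in> parcs G \<and> (a, c) \<in> parcs G \<and> (c, d) \<in> parcs G \<and>
      (a, d) \<notin> parcs G \<and> (b, d) \<notin> parcs G)"
proof -
  have eq: "(\<forall>i\<in>{0, 1, 2, 3}. \<forall>j\<in>{0, 1, 2, 3}.
        (i, j) \<in> parcs paw \<longleftrightarrow> ([a, b, c, d] ! i, [a, b, c, d] ! j) \<in> parcs G) \<longleftrightarrow>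
    (a, b) \<in> parcs G \<and> (b, c) \<in> parcs G \<and> (a, c) \<in> parcs G \<and> (c, d) \<in> parcs G \<and>
      (a, d) \<notin> parcs G \<and> (b, d) \<notin> parcs G" for a b c d
    by (auto simp: paw_def Let_def parcs_commute[of b a] parcs_commute[of c a] parcs_commute[of d a]
        parcs_commute[of c b] parcs_commute[of d b] parcs_commute[of d c])
  have V: "pverts paw = {0, 1, 2, 3}"
    by (simp add: paw_def Let_def)
  have "distinct [a, b, c, d] \<and> {a, b, c, d} \<subseteq> pverts G"
    if "(a, b) \<in> parcs G" "(b, c) \<in> parcs G" "(a, c) \<in> parcs G" "(c, d) \<in> parcs G"
      "(a, d) \<notin> parcs G" "(b, d) \<notin> parcs G" for a b c d
    using that by (intro conjI, simp, metis not_loop arcs_symmetric) (auto dest: wellformed')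
  then show ?thesis
    unfolding has_induced_copy_four_vertices[OF pair_wf_digraph_forbidden(2) pair_wf_digraph_axioms V] eq
    by blast
qed

text \<open>The vertices \<open>a\<close> and \<open>d\<close> are nonadjacent with the same
  neighbours, so a mere triangle with \<open>a = d\<close> would satisfy the adjacency conditions;
  hence the explicit inequality.\<close>

lemma has_induced_copy_diamond_iff:
  "has_induced_copy (with_proj G) (with_proj diamond) \<longleftrightarrow>
    (\<exists>a b c d. (a, b) \<in> parcs G \<and> (a, c) \<in> parcs G \<and> (b, c) \<in> parcs G \<and> (b, d) \<in> parcs G \<and>
      (c, d) \<in> parcs G \<and> (a, d) \<notin> parcs G \<and> a \<noteq> d)"
proof -
  have eq: "(\<forall>i\<in>{0, 1, 2, 3}. \<forall>j\<in>{0, 1, 2, 3}.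
        (i, j) \<in> parcs diamond \<longleftrightarrow> ([a, b, c, d] ! i, [a, b, c, d] ! j) \<in> parcs G) \<longleftrightarrow>
    (a, b) \<in> parcs G \<and> (a, c) \<in> parcs G \<and> (b, c) \<in> parcs G \<and> (b, d) \<in> parcs G \<and>
      (c, d) \<in> parcs G \<and> (a, d) \<notin> parcs G" for a b c d
    by (auto simp: diamond_def Let_def parcs_commute[of b a] parcs_commute[of c a] parcs_commute[of d a]
        parcs_commute[of c b] parcs_commute[of d b] parcs_commute[of d c])
  have V: "pverts diamond = {0, 1, 2, 3}"
    by (simp add: diamond_def Let_def)
  have "distinct [a, b, c, d] \<and> {a, b, c, d} \<subseteq> pverts G"
    if "(a, b) \<in> parcs G" "(a, c) \<in> parcs G" "(b, c) \<in> parcs G" "(b, d) \<in> parcs G"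
      "(c, d) \<in> parcs G" "(a, d) \<notin> parcs G" "a \<noteq> d" for a b c d
    using that by (intro conjI, simp, metis not_loop arcs_symmetric) (auto dest: wellformed')
  moreover have "a \<noteq> d" if "distinct [a, b, c, d]" for a b c d :: 'a
    using that by simp
  ultimately show ?thesis
    unfolding has_induced_copy_four_vertices[OF pair_wf_digraph_forbidden(3) pair_wf_digraph_axioms V] eq
    by meson
qed

section \<open>Forbidden subgraphs yield unit minors\<close>

lemma entry_in_gen_dist_minors:
  assumes "a \<in> pverts G" "b \<in> pverts G"
  shows "gen_dist_entry G a b \<in> (gen_dist_minors G 1 :: (('a \<Rightarrow>\<^sub>0 nat) \<Rightarrow>\<^sub>0 'r::comm_ring_1) set)"
proof -
  have "det (gen_dist_submatrix G [a] [b]) = (gen_dist_entry G a b :: ('a \<Rightarrow>\<^sub>0 nat) \<Rightarrow>\<^sub>0 'r)"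
    by (subst det_single) (auto simp: gen_dist_submatrix_def)
  then show ?thesis
    using det_in_gen_dist_minors[of "[a]" G "[b]", where 'b = 'r] assms by simp
qed

text \<open>The rows \<open>a\<close>, \<open>c\<close> and the columns \<open>b\<close>,
  \<open>d\<close> are disjoint, so the minor avoids the diagonal and contains no
  indeterminate.\<close>

lemma dist_minor_in_gen_dist_minors:
  assumes "distinct [a, b, c, d]" "{a, b, c, d} \<subseteq> pverts G"
  shows "of_nat (graph_dist G a b * graph_dist G c d) - of_nat (graph_dist G a d * graph_dist G c b)
    \<in> (gen_dist_minors G 2 :: (('a \<Rightarrow>\<^sub>0 nat) \<Rightarrow>\<^sub>0 'r::comm_ring_1) set)"
proof -
  let ?M = "gen_dist_submatrix G [a, c] [b, d] :: (('a \<Rightarrow>\<^sub>0 nat) \<Rightarrow>\<^sub>0 'r) mat"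
  have "det ?M = of_nat (graph_dist G a b * graph_dist G c d) - of_nat (graph_dist G a d * graph_dist G c b)"
    using assms(1) by (subst det_two) (auto simp: gen_dist_submatrix_def gen_dist_entry_def)
  moreover have "det ?M \<in> gen_dist_minors G (length [a, c])"
    using assms by (intro det_in_gen_dist_minors) auto
  ultimately show ?thesis
    by (simp add: numeral_2_eq_2)
qed

lemma distance_ideal_1_trivial:
  assumes "(a, b) \<in> parcs G"
  shows "(distance_ideal G 1 :: (('a \<Rightarrow>\<^sub>0 nat) \<Rightarrow>\<^sub>0 'r::comm_ring_1) set) = Idl\<^bsub>poly_ring (pverts G)\<^esub> {1}"
proof -
  have "a \<noteq> b" using assms by auto
  then have "(1 :: ('a \<Rightarrow>\<^sub>0 nat) \<Rightarrow>\<^sub>0 'r) = gen_dist_entry G a b"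
    using graph_dist_adj[OF assms] by (simp add: gen_dist_entry_def)
  then have "(1 :: ('a \<Rightarrow>\<^sub>0 nat) \<Rightarrow>\<^sub>0 'r) \<in> gen_dist_minors G 1"
    using entry_in_gen_dist_minors[of a b] wellformed'[OF assms] by metis
  then show ?thesis
    by (rule distance_ideal_trivialI[of _ _ _ 1]) (simp_all add: poly_ring_def)
qed

lemma distance_ideal_2_trivial:
  assumes abcd: "distinct [a, b, c, d]" "{a, b, c, d} \<subseteq> pverts G"
    and "\<bar>int (graph_dist G a b * graph_dist G c d) - int (graph_dist G a d * graph_dist G c b)\<bar> = 1"
  shows "(distance_ideal G 2 :: (('a \<Rightarrow>\<^sub>0 nat) \<Rightarrow>\<^sub>0 'r::comm_ring_1) set) = Idl\<^bsub>poly_ring (pverts G)\<^esub> {1}"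
proof -
  define k where "k = int (graph_dist G a b * graph_dist G c d) - int (graph_dist G a d * graph_dist G c b)"
  have "(of_int k :: ('a \<Rightarrow>\<^sub>0 nat) \<Rightarrow>\<^sub>0 'r) \<in> gen_dist_minors G 2"
    using dist_minor_in_gen_dist_minors[OF abcd] unfolding k_def by simp
  moreover have k: "k = 1 \<or> k = - 1"
    using assms(3) unfolding k_def by linarith
  \<comment> \<open>As \<open>k\<close> is 1 or -1, the minor is its own inverse.\<close>
  ultimately show ?thesis
    by (intro distance_ideal_trivialI[of "of_int k" _ _ "of_int k"]) (auto simp: poly_ring_def)
qed

text \<open>A forbidden subgraph supplies an arc, which makes the first ideal trivial, and a minor
  of order two equal to 1 or -1, which makes the second one trivial. These are units over every
  coefficient ring.\<close>

lemma induced_free_if_one_trivial: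
  assumes "card {i \<in> {1..card (pverts G)}.
    (distance_ideal G i :: (('a \<Rightarrow>\<^sub>0 nat) \<Rightarrow>\<^sub>0 'r::comm_ring_1) set) = Idl\<^bsub>poly_ring (pverts G)\<^esub> {1}} \<le> 1"
    (is "card ?T \<le> 1")
  shows "induced_free {P4, paw, diamond} G"
proof (rule ccontr)
  assume neg: "\<not> induced_free {P4, paw, diamond} G"
  have "\<exists>a b c d. distinct [a, b, c, d] \<and> {a, b, c, d} \<subseteq> pverts G \<and> parcs G \<noteq> {} \<and>
    \<bar>int (graph_dist G a b * graph_dist G c d) - int (graph_dist G a d * graph_dist G c b)\<bar> = 1"
  proof -
    consider "has_induced_copy (with_proj G) (with_proj P4)"
      | "has_induced_copy (with_proj G) (with_proj paw)"
      | "has_induced_copy (with_proj G) (with_proj diamond)"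
      using neg by (auto simp: induced_free_def)
    then show ?thesis
    proof cases
      case 1
      then obtain a b c d where e: "(a, b) \<in> parcs G" "(b, c) \<in> parcs G" "(c, d) \<in> parcs G"
        "(a, c) \<notin> parcs G" "(a, d) \<notin> parcs G" "(b, d) \<notin> parcs G"
        unfolding has_induced_copy_P4_iff by blast
      have dis: "distinct [a, b, c, d]" "{a, b, c, d} \<subseteq> pverts G"
        using e by (simp, metis not_loop arcs_symmetric) (use e in \<open>auto dest: wellformed'\<close>)
      have d: "graph_dist G a b = 1" "graph_dist G c d = 1" "graph_dist G c b = 1" "graph_dist G b c = 1"
        "graph_dist G a c = 2" "graph_dist G b d = 2"
        using e dis parcs_commute[of b c] by (simp_all add: graph_dist_adj graph_dist_common_neighbour[of a b c] graph_dist_common_neighbour[of b c d])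
      have "graph_dist G a d \<in> {2, 3}"
        using e dis by (intro graph_dist_path_3)
      then consider "graph_dist G a d = 2" | "graph_dist G a d = 3" by blast
      then show ?thesis
      proof cases
        case 1
        \<comment> \<open>Rows \<open>a\<close>, \<open>c\<close> and columns \<open>b\<close>,
          \<open>d\<close> give \<open>1 * 1 - 2 * 1 = - 1\<close>.\<close>
        then show ?thesis
          using e dis d by (intro exI[of _ a] exI[of _ b] exI[of _ c] exI[of _ d]) auto
      next
        case 2
        \<comment> \<open>The previous minor would be -2; rows \<open>a\<close>, \<open>b\<close>
          and columns \<open>c\<close>, \<open>d\<close> give
          \<open>2 * 2 - 3 * 1 = 1\<close>.\<close>
        then show ?thesis
          using e dis d by (intro exI[of _ a] exI[of _ c] exI[of _ b] exI[of _ d]) auto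
      qed
    next
      case 2
      then obtain a b c d where e: "(a, b) \<in> parcs G" "(b, c) \<in> parcs G" "(a, c) \<in> parcs G" "(c, d) \<in> parcs G"
        "(a, d) \<notin> parcs G" "(b, d) \<notin> parcs G"
        unfolding has_induced_copy_paw_iff by blast
      have dis: "distinct [a, b, c, d]" "{a, b, c, d} \<subseteq> pverts G"
        using e by (simp, metis not_loop arcs_symmetric) (use e in \<open>auto dest: wellformed'\<close>)
      have "graph_dist G a b = 1" "graph_dist G c d = 1" "graph_dist G c b = 1" "graph_dist G a d = 2"
        using e dis parcs_commute[of b c] by (simp_all add: graph_dist_adj graph_dist_common_neighbour[of a c d])
      \<comment> \<open>Only the distance from \<open>a\<close> to \<open>d\<close> differs from 1,
        so the minor is \<open>1 * 1 - 2 * 1 = - 1\<close>; the diamond below gives the same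
        value.\<close>
      then show ?thesis
        using e dis by (intro exI[of _ a] exI[of _ b] exI[of _ c] exI[of _ d]) auto
    next
      case 3
      then obtain a b c d where e: "(a, b) \<in> parcs G" "(a, c) \<in> parcs G" "(b, c) \<in> parcs G"
        "(b, d) \<in> parcs G" "(c, d) \<in> parcs G" "(a, d) \<notin> parcs G" "a \<noteq> d"
        unfolding has_induced_copy_diamond_iff by blast
      have dis: "distinct [a, b, c, d]" "{a, b, c, d} \<subseteq> pverts G"
        using e by (simp, metis not_loop arcs_symmetric) (use e in \<open>auto dest: wellformed'\<close>)
      have "graph_dist G a b = 1" "graph_dist G c d = 1" "graph_dist G c b = 1" "graph_dist G a d = 2"
        using e dis parcs_commute[of b c] by (simp_all add: graph_dist_adj graph_dist_common_neighbour[of a b d])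
      then show ?thesis
        using e dis by (intro exI[of _ a] exI[of _ b] exI[of _ c] exI[of _ d]) auto
    qed
  qed
  then obtain a b c d where dis: "distinct [a, b, c, d]" "{a, b, c, d} \<subseteq> pverts G" and "parcs G \<noteq> {}"
    and "\<bar>int (graph_dist G a b * graph_dist G c d) - int (graph_dist G a d * graph_dist G c b)\<bar> = 1"
    by blast
  \<comment> \<open>Four vertices ensure that the indices 1 and 2 lie in the range over which
    trivial ideals are counted.\<close>
  moreover have "card {a, b, c, d} \<le> card (pverts G)"
    using dis by (intro card_mono) auto
  ultimately have "1 \<in> ?T" "2 \<in> ?T"
    using dis distance_ideal_1_trivial distance_ideal_2_trivial[OF dis] by auto
  then have "card {1, 2 :: nat} \<le> card ?T"
    by (intro card_mono) auto
  with assms show False by simp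
qed


section \<open>Structure of the graphs without forbidden subgraphs\<close>

text \<open>Arcs are symmetric, so connectedness gives a directed walk from \<open>u\<close> to
  \<open>v\<close>, along which the property propagates.\<close>

lemma connected_induct [consumes 3, case_names base step]:
  assumes "Digraph_Component.connected (with_proj G)" "u \<in> pverts G" "v \<in> pverts G"
    and "P u" and "\<And>x y. P x \<Longrightarrow> (x, y) \<in> parcs G \<Longrightarrow> P y"
  shows "P v"
proof -
  have "u \<rightarrow>\<^sup>*\<^bsub>with_proj G\<^esub> v"
    using symmetric_connected_imp_strongly_connected[OF pair_sym_arcs assms(1)] assms(2,3)
    by auto
  then show ?thesis
    unfolding reachable_def using assms(4)
    by (induction rule: rtrancl_on_induct) (auto intro: assms(5))
qed

text \<open>The ball of radius 2 around \<open>u\<close> is closed under adjacency: a chord of a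
  path \<open>u\<close>, \<open>w\<close>, \<open>x\<close>, \<open>y\<close> brings
  \<open>y\<close> back within distance 2.\<close>

lemma common_neighbour_if_P4_free:
  assumes conn: "Digraph_Component.connected (with_proj G)"
    and P4: "\<And>a b c d. (a, b) \<in> parcs G \<Longrightarrow> (b, c) \<in> parcs G \<Longrightarrow> (c, d) \<in> parcs G \<Longrightarrow>
      (a, c) \<in> parcs G \<or> (a, d) \<in> parcs G \<or> (b, d) \<in> parcs G"
    and "u \<in> pverts G" "v \<in> pverts G" "u \<noteq> v" "(u, v) \<notin> parcs G"
  obtains w where "(u, w) \<in> parcs G" "(w, v) \<in> parcs G"
proof -
  have "v = u \<or> (u, v) \<in> parcs G \<or> (\<exists>w. (u, w) \<in> parcs G \<and> (w, v) \<in> parcs G)"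
    using conn assms(3,4)
  proof (induction rule: connected_induct)
    case (step x y)
    then show ?case
      using P4[of u _ x y] by blast
  qed simp
  then show thesis
    using assms(5,6) that by blast
qed

text \<open>Triangles spread along arcs, so every vertex lies on one. For nonadjacent
  \<open>u\<close> and \<open>v\<close> with common neighbour \<open>w\<close>, a triangle at
  \<open>w\<close> yields one containing both \<open>u\<close> and \<open>w\<close>, and then
  \<open>v\<close>, as a neighbour of \<open>w\<close>, must be adjacent to
  \<open>u\<close>.\<close>

lemma complete_if_triangle:
  assumes conn: "Digraph_Component.connected (with_proj G)"
    and P4: "\<And>a b c d. (a, b) \<in> parcs G \<Longrightarrow> (b, c) \<in> parcs G \<Longrightarrow> (c, d) \<in> parcs G \<Longrightarrow>
      (a, c) \<in> parcs G \<or> (a, d) \<in> parcs G \<or> (b, d) \<in> parcs G"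
    and paw: "\<And>a b c d. (a, b) \<in> parcs G \<Longrightarrow> (b, c) \<in> parcs G \<Longrightarrow> (a, c) \<in> parcs G \<Longrightarrow>
      (c, d) \<in> parcs G \<Longrightarrow> (a, d) \<in> parcs G \<or> (b, d) \<in> parcs G"
    and diamond: "\<And>a b c d. (a, b) \<in> parcs G \<Longrightarrow> (a, c) \<in> parcs G \<Longrightarrow> (b, c) \<in> parcs G \<Longrightarrow>
      (b, d) \<in> parcs G \<Longrightarrow> (c, d) \<in> parcs G \<Longrightarrow> (a, d) \<in> parcs G \<or> a = d"
    and triangle: "(a, b) \<in> parcs G" "(b, c) \<in> parcs G" "(a, c) \<in> parcs G"
    and u: "u \<in> pverts G" and v: "v \<in> pverts G" and "u \<noteq> v"
  shows "(u, v) \<in> parcs G"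
proof (rule ccontr)
  note sym = arcs_symmetric
  \<comment> \<open>For a neighbour \<open>z\<close> of the triangle vertex \<open>y\<close>,
    paw-freeness joins \<open>z\<close> to \<open>x\<close> or \<open>w\<close>; if it is
    \<open>w\<close>, diamond-freeness gives \<open>x\<close> as well, unless
    \<open>x = z\<close>.\<close>
  have extend: "(x, z) \<in> parcs G \<or> x = z" if "(x, y) \<in> parcs G" "(y, w) \<in> parcs G" "(x, w) \<in> parcs G"
    "(y, z) \<in> parcs G" for x y w z
    using paw[of x w y z] diamond[of x y w z] that sym by meson
  \<comment> \<open>A neighbour \<open>y\<close> of \<open>x\<close> is either \<open>p\<close>
    itself or forms a triangle with \<open>x\<close> and \<open>p\<close>.\<close>
  have spread: "\<exists>p q. (y, p) \<in> parcs G \<and> (p, q) \<in> parcs G \<and> (y, q) \<in> parcs G"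
    if "(x, p) \<in> parcs G" "(p, q) \<in> parcs G" "(x, q) \<in> parcs G" "(x, y) \<in> parcs G" for x y p q
  proof (cases "y = p")
    case True
    then show ?thesis using that sym by blast
  next
    case False
    then have "(p, y) \<in> parcs G"
      using extend[of p x q y] that sym by blast
    then show ?thesis using that sym by blast
  qed
  assume nonadj: "(u, v) \<notin> parcs G"
  then obtain w where w: "(u, w) \<in> parcs G" "(w, v) \<in> parcs G"
    using common_neighbour_if_P4_free[OF conn P4 u v \<open>u \<noteq> v\<close>] by blast
  have "\<exists>p q. (w, p) \<in> parcs G \<and> (p, q) \<in> parcs G \<and> (w, q) \<in> parcs G"
    using conn in_arcsD1[OF triangle(1)] in_arcsD2[OF w(1)]
  proof (induction rule: connected_induct)
    case base
    then show ?case using triangle by blast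
  next
    case (step x y)
    then show ?case using spread by meson
  qed
  then obtain p q where pq: "(w, p) \<in> parcs G" "(p, q) \<in> parcs G" "(w, q) \<in> parcs G"
    by blast
  \<comment> \<open>The third vertex of a triangle on \<open>u\<close> and \<open>w\<close> is
    \<open>p\<close>, or \<open>q\<close> when \<open>u\<close> is \<open>p\<close> itself.\<close>
  obtain r where "(u, r) \<in> parcs G" "(w, r) \<in> parcs G"
  proof (cases "u = p")
    case True
    then show thesis using that pq by blast
  next
    case False
    then show thesis using that[of p] extend[of p w q u] pq w sym by blast
  qed
  then show False
    using extend[of u w r v] w nonadj \<open>u \<noteq> v\<close> by blast
qed

text \<open>The sides are the neighbourhood of \<open>r\<close> and its complement, which contains
  \<open>r\<close>. Two neighbours of \<open>r\<close> are nonadjacent because there is no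
  triangle.\<close>

lemma bipartite_if_triangle_free:
  assumes conn: "Digraph_Component.connected (with_proj G)"
    and P4: "\<And>a b c d. (a, b) \<in> parcs G \<Longrightarrow> (b, c) \<in> parcs G \<Longrightarrow> (c, d) \<in> parcs G \<Longrightarrow>
      (a, c) \<in> parcs G \<or> (a, d) \<in> parcs G \<or> (b, d) \<in> parcs G"
    and tf: "\<And>a b c. (a, b) \<in> parcs G \<Longrightarrow> (b, c) \<in> parcs G \<Longrightarrow> (a, c) \<notin> parcs G"
    and r: "r \<in> pverts G" and u: "u \<in> pverts G" and v: "v \<in> pverts G"
  shows "(u, v) \<in> parcs G \<longleftrightarrow> ((r, u) \<in> parcs G \<longleftrightarrow> (r, v) \<notin> parcs G)"
proof -
  note sym = arcs_symmetric
  have nbr: "\<exists>w. (r, w) \<in> parcs G \<and> (w, x) \<in> parcs G" if "x \<in> pverts G" "x \<noteq> r" "(r, x) \<notin> parcs G" for x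
    using common_neighbour_if_P4_free[OF conn P4 r that(1)] that(2,3) by metis
  have across: "(x, y) \<in> parcs G" if x: "(r, x) \<in> parcs G" and y: "y \<in> pverts G" "(r, y) \<notin> parcs G" for x y
  proof (cases "y = r")
    case True
    then show ?thesis using x sym by blast
  next
    case False
    then obtain w where w: "(r, w) \<in> parcs G" "(w, y) \<in> parcs G"
      using nbr y by blast
    \<comment> \<open>Among the possible chords of \<open>x\<close>, \<open>r\<close>,
      \<open>w\<close>, \<open>y\<close>, the pair \<open>x\<close>, \<open>w\<close> would close a
      triangle with \<open>r\<close>, and \<open>r\<close>, \<open>y\<close> are nonadjacent; only
      the arc from \<open>x\<close> to \<open>y\<close> remains.\<close>
    show ?thesis
      using P4[of x r w y] x y w tf sym by meson
  qed
  have away: "(x, y) \<notin> parcs G" if x: "x \<in> pverts G" "(r, x) \<notin> parcs G" and y: "y \<in> pverts G" "(r, y) \<notin> parcs G" for x y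
  proof
    assume xy: "(x, y) \<in> parcs G"
    then have "x \<noteq> r" "y \<noteq> r" using x y sym by blast+
    then obtain w where w: "(r, w) \<in> parcs G" "(w, x) \<in> parcs G"
      using nbr x by blast
    \<comment> \<open>The vertex \<open>w\<close> is adjacent to \<open>x\<close> and, by
      \<open>across\<close>, to \<open>y\<close>, which makes a triangle.\<close>
    then show False
      using across[OF w(1) y] xy tf by blast
  qed
  show ?thesis
    using across[of u v] across[of v u] away[of u v] u v tf[of r u v] sym by blast
qed

end

section \<open>Embeddings into complete and complete bipartite graphs on natural numbers\<close>

text \<open>The host is \<open>G\<close> itself with its vertices renamed by an injection into the
  naturals; a nonempty vertex set makes its order positive.\<close>

lemma has_induced_copy_complete:
  assumes "pair_graph G" "pverts G \<noteq> {}"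
    and complete: "\<And>u v. u \<in> pverts G \<Longrightarrow> v \<in> pverts G \<Longrightarrow> (u, v) \<in> parcs G \<longleftrightarrow> u \<noteq> v"
  shows "\<exists>(n::nat) (K :: nat pair_pre_digraph). n > 0 \<and>
    K\<^bsub>n\<^esub> (with_proj K) \<and> has_induced_copy (with_proj K) (with_proj G)"
proof -
  interpret pair_graph G by fact
  obtain f :: "'a \<Rightarrow> nat" where inj: "inj_on f (pverts G)"
    using pair_finite_verts finite_imp_inj_to_nat_seg by metis
  define K where "K = \<lparr>pverts = f ` pverts G, parcs = {(u, v). (u, v) \<in> f ` pverts G \<times> f ` pverts G \<and> u \<noteq> v}\<rparr>"
  have K: "K\<^bsub>card (f ` pverts G)\<^esub> (with_proj K)"
    unfolding complete_digraph_pair_def using pair_finite_verts by (simp add: K_def)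
  then have "pair_wf_digraph K"
    using pair_graphI_complete pair_graph_def pair_digraph_def pair_fin_digraph_def by blast
  then have "has_induced_copy (with_proj K) (with_proj G)"
    using inj complete
    by (subst has_induced_copy_iff[OF pair_wf_digraph_axioms])
      (auto intro!: exI[of _ f] simp: K_def inj_on_eq_iff)
  moreover have "card (f ` pverts G) > 0"
    using assms(2) pair_finite_verts by (simp add: card_gt_0_iff)
  ultimately show ?thesis
    using K by blast
qed

text \<open>The vertex \<open>r\<close> outside \<open>S\<close> makes the second side of the host
  nonempty.\<close>

lemma has_induced_copy_complete_bipartite:
  assumes "pair_graph G" "r \<in> pverts G" "r \<notin> S"
    and bipartite: "\<And>u v. u \<in> pverts G \<Longrightarrow> v \<in> pverts G \<Longrightarrow> (u, v) \<in> parcs G \<longleftrightarrow> (u \<in> S \<longleftrightarrow> v \<notin> S)"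
  shows "\<exists>(m::nat) (n::nat) (K :: nat pair_pre_digraph). m > 0 \<and> n > 0 \<and>
    K\<^bsub>m,n\<^esub> (with_proj K) \<and> has_induced_copy (with_proj K) (with_proj G)"
proof -
  interpret pair_graph G by fact
  obtain h :: "'a \<Rightarrow> nat" where inj: "inj_on h (pverts G)"
    using pair_finite_verts finite_imp_inj_to_nat_seg by metis
  \<comment> \<open>The parity records the side, which keeps the sides disjoint, and halving
    recovers \<open>h u\<close>, which keeps the map injective.\<close>
  define f where "f u = (if u \<in> S then 2 * h u + 1 else 2 * h u)" for u
  \<comment> \<open>The additional vertex \<open>1\<close> keeps this side nonempty when \<open>G\<close> is a single vertex.\<close>
  define A where "A = insert 1 (f ` (pverts G \<inter> S))"
  define B where "B = f ` (pverts G - S)"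
  define K where "K = \<lparr>pverts = A \<union> B, parcs = A \<times> B \<union> B \<times> A\<rparr>"
  have odd: "odd a" if "a \<in> A" for a
    using that by (auto simp: A_def f_def)
  have even: "even b" if "b \<in> B" for b
    using that by (auto simp: B_def f_def)
  have fin: "finite A" "finite B"
    using pair_finite_verts by (simp_all add: A_def B_def)
  have disj: "A \<inter> B = {}"
    using odd even by blast
  have K: "K\<^bsub>card A,card B\<^esub> (with_proj K)"
    unfolding complete_bipartite_digraph_pair_def using fin disj by (auto simp: K_def)
  then have wf: "pair_wf_digraph K"
    using pair_graphI_complete_bipartite pair_graph_def pair_digraph_def pair_fin_digraph_def by blast
  have inj_f: "inj_on f (pverts G)"
  proof (rule inj_onI)
    fix u v assume uv: "u \<in> pverts G" "v \<in> pverts G" "f u = f v"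
    have "f w div 2 = h w" for w
      by (simp add: f_def)
    then have "h u = h v"
      using uv(3) by metis
    then show "u = v"
      using inj uv by (simp add: inj_on_eq_iff)
  qed
  have mem: "f u \<in> A \<longleftrightarrow> u \<in> S" "f u \<in> B \<longleftrightarrow> u \<notin> S" if "u \<in> pverts G" for u
  proof -
    have "u \<in> S \<Longrightarrow> f u \<in> A" "u \<notin> S \<Longrightarrow> f u \<in> B"
      using that by (auto simp: A_def B_def)
    then show "f u \<in> A \<longleftrightarrow> u \<in> S" "f u \<in> B \<longleftrightarrow> u \<notin> S"
      using disj by blast+
  qed
  have "has_induced_copy (with_proj K) (with_proj G)"
    unfolding has_induced_copy_iff[OF pair_wf_digraph_axioms wf]
    using inj_f mem bipartite by (intro exI[of _ f]) (auto simp: K_def)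
  moreover have "card A > 0" "card B > 0"
    using fin assms(2,3) by (auto simp: card_gt_0_iff A_def B_def)
  ultimately show ?thesis
    using K by blast
qed

context pair_graph
begin

lemma induced_freeD:
  assumes "induced_free {P4, paw, diamond} G"
  shows "(a, b) \<in> parcs G \<Longrightarrow> (b, c) \<in> parcs G \<Longrightarrow> (c, d) \<in> parcs G \<Longrightarrow>
      (a, c) \<in> parcs G \<or> (a, d) \<in> parcs G \<or> (b, d) \<in> parcs G"
    and "(a, b) \<in> parcs G \<Longrightarrow> (b, c) \<in> parcs G \<Longrightarrow> (a, c) \<in> parcs G \<Longrightarrow>
      (c, d) \<in> parcs G \<Longrightarrow> (a, d) \<in> parcs G \<or> (b, d) \<in> parcs G"
    and "(a, b) \<in> parcs G \<Longrightarrow> (a, c) \<in> parcs G \<Longrightarrow> (b, c) \<in> parcs G \<Longrightarrow>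
      (b, d) \<in> parcs G \<Longrightarrow> (c, d) \<in> parcs G \<Longrightarrow> (a, d) \<in> parcs G \<or> a = d"
  using assms has_induced_copy_P4_iff has_induced_copy_paw_iff has_induced_copy_diamond_iff
  by (simp_all add: induced_free_def)

lemma induced_copy_if_induced_free:
  assumes conn: "Digraph_Component.connected (with_proj G)" and free: "induced_free {P4, paw, diamond} G"
  shows "(\<exists>(m::nat) (n::nat) (K :: nat pair_pre_digraph). m > 0 \<and> n > 0 \<and>
              K\<^bsub>m,n\<^esub> (with_proj K) \<and> has_induced_copy (with_proj K) (with_proj G))
         \<or> (\<exists>(n::nat) (K :: nat pair_pre_digraph). n > 0 \<and>
              K\<^bsub>n\<^esub> (with_proj K) \<and> has_induced_copy (with_proj K) (with_proj G))"
proof (cases "\<exists>a b c. (a, b) \<in> parcs G \<and> (b, c) \<in> parcs G \<and> (a, c) \<in> parcs G")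
  case True
  then obtain a b c where abc: "(a, b) \<in> parcs G" "(b, c) \<in> parcs G" "(a, c) \<in> parcs G"
    by blast
  have "(u, v) \<in> parcs G \<longleftrightarrow> u \<noteq> v" if "u \<in> pverts G" "v \<in> pverts G" for u v
    using complete_if_triangle[OF conn induced_freeD[OF free] abc that] by auto
  then show ?thesis
    using has_induced_copy_complete[OF pair_graph] in_arcsD1[OF abc(1)] by blast
next
  case False
  \<comment> \<open>Connectedness includes having a vertex. Without loops, \<open>r\<close> lies
    outside its own neighbourhood, which serves as one side.\<close>
  obtain r where r: "r \<in> pverts G"
    using conn by (auto simp: connected_conv)
  have "(u, v) \<in> parcs G \<longleftrightarrow> (u \<in> {u. (r, u) \<in> parcs G} \<longleftrightarrow> v \<notin> {u. (r, u) \<in> parcs G})"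
    if "u \<in> pverts G" "v \<in> pverts G" for u v
    using bipartite_if_triangle_free[OF conn induced_freeD(1)[OF free] _ r that] False by blast
  then show ?thesis
    using has_induced_copy_complete_bipartite[OF pair_graph r, of "{u. (r, u) \<in> parcs G}"] by simp
qed

section \<open>Complete and complete bipartite graphs\<close>

text \<open>With every indeterminate equal to 1 the matrix is the all-ones matrix, of rank one over
  the integers; the modulus 0 turns congruence into equality.\<close>

lemma distance_ideal_nontrivial_complete:
  assumes complete: "\<And>u v. u \<in> pverts G \<Longrightarrow> v \<in> pverts G \<Longrightarrow> u \<noteq> v \<Longrightarrow> (u, v) \<in> parcs G"
    and "i \<ge> 2"
  shows "(distance_ideal G i :: (('a \<Rightarrow>\<^sub>0 nat) \<Rightarrow>\<^sub>0 int) set) \<noteq> Idl\<^bsub>poly_ring (pverts G)\<^esub> {1}"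
proof (rule distance_ideal_nontrivial[of G "\<lambda>_. 1" "\<lambda>_. 1" "\<lambda>_. 1" 0])
  fix u v assume "u \<in> pverts G" "v \<in> pverts G"
  interpret hom: comm_ring_hom "poly_eval (\<lambda>_ :: 'a. 1 :: int)"
    by (rule comm_ring_hom_poly_eval)
  show "[poly_eval (\<lambda>_. 1) (gen_dist_entry G u v) = 1 * 1 :: int] (mod 0)"
    using \<open>u \<in> pverts G\<close> graph_dist_adj[OF complete] \<open>v \<in> pverts G\<close>
    by (auto simp: gen_dist_entry_def graph_dist_self poly_eval_indet hom.hom_add hom.hom_of_nat)
qed (use assms(2) in auto)

text \<open>
  With every indeterminate equal to 2, the entries are 2 within a side and 1 across, and \<open>2 \<equiv> - 1\<close>
  modulo 3.
\<close>

lemma distance_ideal_nontrivial_bipartite: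
  assumes conn: "Digraph_Component.connected (with_proj G)"
    and bipartite: "\<And>u v. u \<in> pverts G \<Longrightarrow> v \<in> pverts G \<Longrightarrow> (u, v) \<in> parcs G \<longleftrightarrow> (u \<in> S \<longleftrightarrow> v \<notin> S)"
    and "i \<ge> 2"
  shows "(distance_ideal G i :: (('a \<Rightarrow>\<^sub>0 nat) \<Rightarrow>\<^sub>0 int) set) \<noteq> Idl\<^bsub>poly_ring (pverts G)\<^esub> {1}"
proof -
  define s :: "'a \<Rightarrow> int" where "s u = (if u \<in> S then 1 else - 1)" for u
  interpret hom: comm_ring_hom "poly_eval (\<lambda>_ :: 'a. 2 :: int)"
    by (rule comm_ring_hom_poly_eval)
  show ?thesis
  \<comment> \<open>The product \<open>s u * - s v\<close> is 1 across the sides and -1 within a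
    side, where -1 agrees with 2 modulo 3.\<close>
  proof (rule distance_ideal_nontrivial[of G "\<lambda>_. 2" s "\<lambda>v. - s v" 3])
    fix u v assume u: "u \<in> pverts G" and v: "v \<in> pverts G"
    show "[poly_eval (\<lambda>_. 2) (gen_dist_entry G u v) = s u * - s v] (mod 3)"
    proof (cases "u = v")
      case True
      then show ?thesis
        using u by (simp add: gen_dist_entry_def graph_dist_self poly_eval_indet s_def cong_def)
    next
      case neq: False
      then have eval: "poly_eval (\<lambda>_. 2 :: int) (gen_dist_entry G u v) = int (graph_dist G u v)"
        by (simp add: gen_dist_entry_def hom.hom_of_nat)
      show ?thesis
      proof (cases "(u, v) \<in> parcs G")
        case True
        then show ?thesis
          using bipartite[OF u v] by (auto simp: eval graph_dist_adj s_def cong_def)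
      next
        case False
        \<comment> \<open>Since \<open>u\<close> and \<open>v\<close> are distinct, connectedness
          gives \<open>u\<close> a neighbour \<open>w\<close>. It lies on the other side, hence is
          also adjacent to \<open>v\<close>.\<close>
        have "v = u \<or> (\<exists>w. (u, w) \<in> parcs G)"
          using conn u v by (induction rule: connected_induct) auto
        then obtain w where w: "(u, w) \<in> parcs G"
          using neq by blast
        then have "(w, v) \<in> parcs G"
          using bipartite u v False in_arcsD2[OF w] by blast
        then have "graph_dist G u v = 2"
          using graph_dist_common_neighbour w neq False by blast
        then show ?thesis
          using False bipartite[OF u v] by (auto simp: eval s_def cong_def)
      qed
    qed
  qed (use assms(3) in auto)
qed

text \<open>The structure of the host is pulled back along the embedding: the preimage of
  \<open>A\<close> gives a bipartition of \<open>G\<close>, or \<open>G\<close> is complete.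
  Distances are then computed in \<open>G\<close>, not in the host.\<close>

lemma nontrivial_if_induced_copy:
  assumes conn: "Digraph_Component.connected (with_proj G)"
    and K: "K\<^bsub>m,n\<^esub> (with_proj K) \<or> K\<^bsub>n\<^esub> (with_proj K)"
    and copy: "has_induced_copy (with_proj K) (with_proj G)" and i: "i \<ge> 2"
  shows "(distance_ideal G i :: (('a \<Rightarrow>\<^sub>0 nat) \<Rightarrow>\<^sub>0 int) set) \<noteq> Idl\<^bsub>poly_ring (pverts G)\<^esub> {1}"
proof -
  have "pair_wf_digraph K"
    using K pair_graphI_complete_bipartite pair_graphI_complete pair_graph_def pair_digraph_def pair_fin_digraph_def
    by blast
  then obtain f where inj: "inj_on f (pverts G)" and f: "f ` pverts G \<subseteq> pverts K"
    and adj: "\<And>u v. u \<in> pverts G \<Longrightarrow> v \<in> pverts G \<Longrightarrow> (u, v) \<in> parcs G \<longleftrightarrow> (f u, f v) \<in> parcs K"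
    using copy has_induced_copy_iff[OF pair_wf_digraph_axioms] by metis
  from K show ?thesis
  proof
    assume "K\<^bsub>m,n\<^esub> (with_proj K)"
    then obtain A B where AB: "pverts K = A \<union> B" "A \<inter> B = {}" "parcs K = A \<times> B \<union> B \<times> A"
      unfolding complete_bipartite_digraph_pair_def by blast
    have "(u, v) \<in> parcs G \<longleftrightarrow> (u \<in> f -` A \<longleftrightarrow> v \<notin> f -` A)" if "u \<in> pverts G" "v \<in> pverts G" for u v
    proof -
      have "f u \<in> A \<union> B" "f v \<in> A \<union> B"
        using that f AB(1) by auto
      then show ?thesis
        using adj[OF that] AB(2,3) by auto
    qed
    then show ?thesis
      by (rule distance_ideal_nontrivial_bipartite[OF conn _ i])
  next
    assume "K\<^bsub>n\<^esub> (with_proj K)"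
    then have "parcs K = {(u, v). (u, v) \<in> pverts K \<times> pverts K \<and> u \<noteq> v}"
      unfolding complete_digraph_pair_def by blast
    then have "(u, v) \<in> parcs G" if "u \<in> pverts G" "v \<in> pverts G" "u \<noteq> v" for u v
      using adj[OF that(1,2)] f that inj by (auto simp: inj_on_eq_iff)
    then show ?thesis
      by (rule distance_ideal_nontrivial_complete[OF _ i])
  qed
qed

end

theorem theorem23:
  fixes G :: "'a pair_pre_digraph"
  assumes "pair_graph G" and "Digraph_Component.connected (with_proj G)"
  shows
    "(card {i \<in> {1..card (pverts G)}.
         (distance_ideal G i :: (('a \<Rightarrow>\<^sub>0 nat) \<Rightarrow>\<^sub>0 int) set) = Idl\<^bsub>poly_ring (pverts G)\<^esub> {1}} \<le> 1
       \<longleftrightarrow> induced_free {P4, paw, diamond} G)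
     \<and>
     (induced_free {P4, paw, diamond} G
       \<longleftrightarrow> (\<exists>(m::nat) (n::nat) (K :: nat pair_pre_digraph). m > 0 \<and> n > 0 \<and>
              K\<^bsub>m,n\<^esub> (with_proj K) \<and> has_induced_copy (with_proj K) (with_proj G))
         \<or> (\<exists>(n::nat) (K :: nat pair_pre_digraph). n > 0 \<and>
              K\<^bsub>n\<^esub> (with_proj K) \<and> has_induced_copy (with_proj K) (with_proj G)))"
    (is "(card ?T \<le> 1 \<longleftrightarrow> ?free) \<and> (?free \<longleftrightarrow> ?copy)")
proof -
  interpret pair_graph G by fact
  have "card ?T \<le> 1" if ?copy
  proof -
    have "i = 1" if "i \<in> ?T" for i
    proof (rule ccontr)
      assume "i \<noteq> 1"
      with that have "i \<ge> 2" by auto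
      then show False
        using that nontrivial_if_induced_copy[OF assms(2)] \<open>?copy\<close> by blast
    qed
    \<comment> \<open>An inclusion suffices: for a single vertex even the first ideal is
      nontrivial.\<close>
    then have "?T \<subseteq> {1}" by blast
    then show ?thesis
      using card_mono[of "{1}" ?T] by simp
  qed
  \<comment> \<open>This closes the cycle: few trivial ideals imply freeness, freeness an embedding,
    and an embedding few trivial ideals.\<close>
  then show ?thesis
    using induced_free_if_one_trivial induced_copy_if_induced_free[OF assms(2)] by blast
qed

end
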